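(* Let $\mathsf{Q}=(\mathsf{Q},\&,k)$ be a non-trivial, commutative and unital quantale. Then every $\mathsf{Q}$-map is symmetric if, and only if, $\mathsf{Q}$ is weakly lean.
   Context: A non-trivial, commutative and unital quantale $\mathsf{Q}=(\mathsf{Q},\&,k)$ is a complete lattice $\mathsf{Q}$ (top $\top$, bottom $\bot$) with a commutative monoid structure $(\mathsf{Q},\&,k)$ such that $\bot<k$ and $p\mathbin{\&}\bigvee_{i\in I} q_i=\bigvee_{i\in I} p\mathbin{\&}q_i$ for all families. The operation $\to$ is defined by $p\mathbin{\&}q\le r\iff p\le q\to r$. For sets $X,Y$, a $\mathsf{Q}$-relation $\phi\colon X\nrightarrow Y$ is a function $\phi\colon X\times Y\to\mathsf{Q}$; $\mathsf{Q}$-relations are ordered pointwise. The composite of $\phi\colon X\nrightarrow Y$ and $\psi\colon Y\nrightarrow Z$ is $(\psi\circ\phi)(x,z)=\bigvee_{y\in Y}\psi(y,z)\mathbin{\&}\phi(x,y)$; the identity is $\mathrm{id}_X(x,x)=k$ and $\mathrm{id}_X(x,y)=\bot$ for $x\ne y$. The opposite is $\phi^{\mathrm{op}}(y,x)=\phi(x,y)$. For $\zeta\colon X\nrightarrow Y$ define $\zeta^*\colon Y\nrightarrow X$ by $\zeta^*(y,x)=\bigwedge_{z\in Y}\big(\zeta(x,z)\to\mathrm{id}_Y(y,z)\big)$. A $\mathsf{Q}$-map from $X$ to $Y$ is a $\mathsf{Q}$-relation $\zeta\colon X\nrightarrow Y$ having a right adjoint, i.e. there is $\eta\colon Y\nrightarrow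 X$ with $\mathrm{id}_X\le\eta\circ\zeta$ and $\zeta\circ\eta\le\mathrm{id}_Y$; then necessarily $\eta=\zeta^*$. A $\mathsf{Q}$-map $\zeta\colon X\nrightarrow Y$ is symmetric if $\zeta^*=\zeta^{\mathrm{op}}$. ("Every $\mathsf{Q}$-map" means for all sets $X,Y$ and all $\mathsf{Q}$-maps from $X$ to $Y$.) $\mathsf{Q}$ is weakly lean if for every index set $I$ and all $p_i,q_i\in\mathsf{Q}$ $(i\in I)$: if $\bigvee_{i\in I}p_i\mathbin{\&}q_i=k$ and $p_i\mathbin{\&}q_j=\bot$ for all $i\neq j$, then $k\le\bigvee_{i\in I}(p_i\wedge q_i)\mathbin{\&}(p_i\wedge q_i)$. *)

theory Defs
  imports Main
begin

text \<open>Commutative unital quantales, with \<open>&\<close> written as \<open>*\<close> and \<open>k\<close> as \<open>1\<close>. Non-triviality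
  (\<open>bot < 1\<close>) is not part of the class.\<close>

class comm_unital_quantale = complete_lattice + comm_monoid_mult +
  assumes mult_Sup: "p * Sup S = (SUP q\<in>S. p * q)"

definition qres :: "'q::comm_unital_quantale \<Rightarrow> 'q \<Rightarrow> 'q"  (infixr "\<rightarrow>\<^sub>Q" 60)
  where "q \<rightarrow>\<^sub>Q r = Sup {p. p * q \<le> r}"

lemma qres_adjoint:
  fixes p q r :: "'q::comm_unital_quantale"
  shows "p * q \<le> r \<longleftrightarrow> p \<le> q \<rightarrow>\<^sub>Q r"
proof
  assume "p * q \<le> r"
  then show "p \<le> q \<rightarrow>\<^sub>Q r"
    unfolding qres_def by (auto intro: Sup_upper)
next
  have mono: "q * a \<le> q * b" if "a \<le> b" for a b :: 'q
  proof -
    have "q * b = q * Sup {a, b}" using that by (simp add: sup_absorb2)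
    also have "\<dots> = sup (q * a) (q * b)" by (subst mult_Sup) simp
    finally show ?thesis by (metis sup_ge1)
  qed
  assume "p \<le> q \<rightarrow>\<^sub>Q r"
  then have "q * p \<le> q * (q \<rightarrow>\<^sub>Q r)" by (rule mono)
  also have "\<dots> \<le> r"
    unfolding qres_def mult_Sup by (auto intro: SUP_least simp: mult.commute)
  finally show "p * q \<le> r" by (simp add: mult.commute)
qed

text \<open>Sets are represented as subsets of an arbitrary type \<open>'u\<close>, playing the role of a universe.
  A \<open>Q\<close>-relation from \<open>X\<close> to \<open>Y\<close> is a function \<open>'u \<Rightarrow> 'u \<Rightarrow> 'q\<close> of which only the values on
  \<open>X \<times> Y\<close> matter; so every definition below ranges over the carriers only.\<close>

type_synonym ('u, 'q) qrel = "'u \<Rightarrow> 'u \<Rightarrow> 'q"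

definition qrel_le :: "'u set \<Rightarrow> 'u set \<Rightarrow> ('u, 'q::comm_unital_quantale) qrel \<Rightarrow> ('u, 'q) qrel \<Rightarrow> bool"
  where "qrel_le X Y \<phi> \<psi> \<longleftrightarrow> (\<forall>x\<in>X. \<forall>y\<in>Y. \<phi> x y \<le> \<psi> x y)"

definition qrel_eq :: "'u set \<Rightarrow> 'u set \<Rightarrow> ('u, 'q::comm_unital_quantale) qrel \<Rightarrow> ('u, 'q) qrel \<Rightarrow> bool"
  where "qrel_eq X Y \<phi> \<psi> \<longleftrightarrow> (\<forall>x\<in>X. \<forall>y\<in>Y. \<phi> x y = \<psi> x y)"

text \<open>The first argument of \<open>qrel_comp\<close> is the middle set, over which the join is taken.\<close>

definition qrel_comp :: "'u set \<Rightarrow> ('u, 'q::comm_unital_quantale) qrel \<Rightarrow> ('u, 'q) qrel \<Rightarrow> ('u, 'q) qrel"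
  where "qrel_comp Y \<psi> \<phi> x z = (SUP y\<in>Y. \<psi> y z * \<phi> x y)"

definition qrel_id :: "('u, 'q::comm_unital_quantale) qrel"
  where "qrel_id x y = (if x = y then 1 else bot)"

definition qrel_op :: "('u, 'q::comm_unital_quantale) qrel \<Rightarrow> ('u, 'q) qrel"
  where "qrel_op \<phi> y x = \<phi> x y"

text \<open>\<open>qrel_star Y \<zeta>\<close> is \<open>\<zeta>\<^sup>*\<close> for \<open>\<zeta>\<close> with codomain \<open>Y\<close>.\<close>

definition qrel_star :: "'u set \<Rightarrow> ('u, 'q::comm_unital_quantale) qrel \<Rightarrow> ('u, 'q) qrel"
  where "qrel_star Y \<zeta> y x = (INF z\<in>Y. \<zeta> x z \<rightarrow>\<^sub>Q qrel_id y z)"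

definition is_qmap :: "'u set \<Rightarrow> 'u set \<Rightarrow> ('u, 'q::comm_unital_quantale) qrel \<Rightarrow> bool"
  where "is_qmap X Y \<zeta> \<longleftrightarrow>
    (\<exists>\<eta>. qrel_le X X qrel_id (qrel_comp Y \<eta> \<zeta>) \<and> qrel_le Y Y (qrel_comp X \<zeta> \<eta>) qrel_id)"

definition symmetric_qmap :: "'u set \<Rightarrow> 'u set \<Rightarrow> ('u, 'q::comm_unital_quantale) qrel \<Rightarrow> bool"
  where "symmetric_qmap X Y \<zeta> \<longleftrightarrow> is_qmap X Y \<zeta> \<and> qrel_eq Y X (qrel_star Y \<zeta>) (qrel_op \<zeta>)"

definition weakly_lean :: "'u itself \<Rightarrow> 'q::comm_unital_quantale itself \<Rightarrow> bool"
  where "weakly_lean _ _ \<longleftrightarrow>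
    (\<forall>(I :: 'u set) (p :: 'u \<Rightarrow> 'q) (q :: 'u \<Rightarrow> 'q).
      (SUP i\<in>I. p i * q i) = 1 \<longrightarrow>
      (\<forall>i\<in>I. \<forall>j\<in>I. i \<noteq> j \<longrightarrow> p i * q j = bot) \<longrightarrow>
      1 \<le> (SUP i\<in>I. inf (p i) (q i) * inf (p i) (q i)))"

text \<open>The index sets in the universe \<open>'q \<times> 'q\<close> already suffice: weak leanness with respect to
  them implies weak leanness with respect to every universe.\<close>

lemma weakly_lean_universe:
  assumes "weakly_lean TYPE('q \<times> 'q) TYPE('q::comm_unital_quantale)"
  shows "weakly_lean TYPE('u) TYPE('q)"
  unfolding weakly_lean_def
proof (intro allI impI)
  fix I :: "'u set" and p q :: "'u \<Rightarrow> 'q"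
  let ?J = "(\<lambda>i. (p i, q i)) ` I"
  assume sup: "(SUP i\<in>I. p i * q i) = 1"
    and orth: "\<forall>i\<in>I. \<forall>j\<in>I. i \<noteq> j \<longrightarrow> p i * q j = bot"
  have "(SUP u\<in>?J. fst u * snd u) = 1"
    using sup by (simp add: image_image)
  moreover have "\<forall>u\<in>?J. \<forall>v\<in>?J. u \<noteq> v \<longrightarrow> fst u * snd v = bot"
    using orth by auto
  ultimately have "1 \<le> (SUP u\<in>?J. inf (fst u) (snd u) * inf (fst u) (snd u))"
    using assms unfolding weakly_lean_def by blast
  then show "1 \<le> (SUP i\<in>I. inf (p i) (q i) * inf (p i) (q i))"
    by (simp add: image_image)
qed

end

theory Submission imports Defs begin

text \<open>A \<open>Q\<close>-map may be examined row by row. The two adjunction inequalities for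
  \<open>\<zeta>\<close> and \<open>\<eta>\<close> say that, for each \<open>x\<close>, the row \<open>p = \<zeta>(x, -)\<close> and the column \<open>q = \<eta>(-, x)\<close> are
  dual families: \<open>1\<close> lies below the join of the products \<open>p\<^sub>i & q\<^sub>i\<close>, and the matrix of all
  products \<open>p\<^sub>i & q\<^sub>j\<close> lies below the identity. Different rows do not interact
  (\<open>is_qmap_iff\<close>). In a dual pair each family determines the other, and the value of
  \<open>\<zeta>\<^sup>*\<close> is the dual of the row (\<open>qrel_star_eq_dual\<close>); so \<open>\<zeta>\<close> is symmetric exactly when each
  of its rows is its own dual. Every dual pair arises from a one-row \<open>Q\<close>-map, hence
  ``every \<open>Q\<close>-map is symmetric'' means ``the two members of every dual pair agree''.

  The premises of weak leanness also describe precisely a dual pair, so it remains to compare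
  conclusions (\<open>dual_families_agree_iff\<close>). If \<open>p = q\<close> then the join of \<open>(p\<^sub>i \<and> q\<^sub>i) & (p\<^sub>i \<and> q\<^sub>i)\<close> is just
  the join of \<open>p\<^sub>i & q\<^sub>i\<close>. Conversely, put \<open>r\<^sub>i = p\<^sub>i \<and> q\<^sub>i\<close> and suppose that \<open>1\<close> lies below the join
  of the squares \<open>r\<^sub>i & r\<^sub>i\<close>. Multiplying by \<open>p\<^sub>i\<close> kills all summands but the \<open>i\<close>-th by orthogonality, so
  \<open>p\<^sub>i \<le> p\<^sub>i & r\<^sub>i & r\<^sub>i \<le> (p\<^sub>i & q\<^sub>i) & q\<^sub>i \<le> q\<^sub>i\<close>; by symmetry also \<open>q\<^sub>i \<le> p\<^sub>i\<close>.\<close>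

lemma quantale_mult_mono:
  fixes a b c d :: "'q::comm_unital_quantale"
  assumes "a \<le> b" "c \<le> d"
  shows "a * c \<le> b * d"
proof -
  have left_mono: "u * v \<le> u * w" if "v \<le> w" for u v w :: 'q
  proof -
    have "u * w = sup (u * v) (u * w)"
      using that mult_Sup[of u "{v, w}"] by (simp add: sup_absorb2)
    then show ?thesis by (metis sup_ge1)
  qed
  have "a * c \<le> a * d" using assms(2) by (rule left_mono)
  also have "\<dots> \<le> b * d" using left_mono[OF assms(1), of d] by (simp add: mult.commute)
  finally show ?thesis .
qed

lemma quantale_mult_bot [simp]:
  fixes a :: "'q::comm_unital_quantale"
  shows "a * bot = bot" "bot * a = bot"
  using mult_Sup[of a "{}"] by (simp_all add: mult.commute)

lemma quantale_mult_SUP: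
  fixes a :: "'q::comm_unital_quantale"
  shows "a * (SUP i\<in>I. f i) = (SUP i\<in>I. a * f i)"
  by (simp add: mult_Sup image_image)

text \<open>Both the uniqueness of duals and the consequence of weak leanness come from expanding an
  element along a join above \<open>1\<close> and bounding each summand.\<close>

lemma le_of_unit_le_SUP:
  fixes a c :: "'q::comm_unital_quantale"
  assumes "1 \<le> (SUP i\<in>I. f i)" and "\<And>i. i \<in> I \<Longrightarrow> a * f i \<le> c"
  shows "a \<le> c"
proof -
  have "a \<le> a * (SUP i\<in>I. f i)"
    using quantale_mult_mono[OF order_refl assms(1), of a] by simp
  also have "\<dots> \<le> c"
    unfolding quantale_mult_SUP using assms(2) by (rule SUP_least)
  finally show ?thesis .
qed

definition dual_families :: "'u set \<Rightarrow> ('u \<Rightarrow> 'q::comm_unital_quantale) \<Rightarrow> ('u \<Rightarrow> 'q) \<Rightarrow> bool"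
  where "dual_families I p q \<longleftrightarrow>
    1 \<le> (SUP i\<in>I. p i * q i) \<and> (\<forall>i\<in>I. \<forall>j\<in>I. p i * q j \<le> qrel_id i j)"

lemma dual_families_sym:
  assumes "dual_families I p q"
  shows "dual_families I q p"
proof -
  have "q i * p j \<le> qrel_id i j" if "i \<in> I" "j \<in> I" for i j
    using assms that unfolding dual_families_def by (metis mult.commute qrel_id_def)
  then show ?thesis
    using assms unfolding dual_families_def by (simp add: mult.commute)
qed

text \<open>The diagonal bounds \<open>p i * q i \<le> 1\<close> turn the inequality for the join into an equation, and
  conversely follow from it; this yields the premises of weak leanness.\<close>

lemma dual_families_iff:
  "dual_families I p q \<longleftrightarrow>
    (SUP i\<in>I. p i * q i) = 1 \<and> (\<forall>i\<in>I. \<forall>j\<in>I. i \<noteq> j \<longrightarrow> p i * q j = bot)"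
proof
  assume dual: "dual_families I p q"
  then have below_id: "p i * q j \<le> qrel_id i j" if "i \<in> I" "j \<in> I" for i j
    using that unfolding dual_families_def by blast
  have "p i * q i \<le> 1" if "i \<in> I" for i
    using below_id[OF that that] by (simp add: qrel_id_def)
  then have "(SUP i\<in>I. p i * q i) \<le> 1" by (rule SUP_least)
  moreover have "1 \<le> (SUP i\<in>I. p i * q i)"
    using dual unfolding dual_families_def by blast
  moreover have "p i * q j = bot" if "i \<in> I" "j \<in> I" "i \<noteq> j" for i j
    using below_id[OF that(1,2)] that(3) by (simp add: qrel_id_def bot_unique)
  ultimately show "(SUP i\<in>I. p i * q i) = 1 \<and> (\<forall>i\<in>I. \<forall>j\<in>I. i \<noteq> j \<longrightarrow> p i * q j = bot)"
    by (blast intro: antisym)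
next
  assume *: "(SUP i\<in>I. p i * q i) = 1 \<and> (\<forall>i\<in>I. \<forall>j\<in>I. i \<noteq> j \<longrightarrow> p i * q j = bot)"
  have "p i * q j \<le> qrel_id i j" if ij: "i \<in> I" "j \<in> I" for i j
  proof (cases "i = j")
    case True
    have "p i * q i \<le> (SUP i\<in>I. p i * q i)" using ij(1) by (rule SUP_upper)
    then show ?thesis using * True by (simp add: qrel_id_def)
  next
    case False
    then have "p i * q j = bot" using * ij by blast
    then show ?thesis by simp
  qed
  moreover have "1 \<le> (SUP i\<in>I. p i * q i)" using * by (metis order_refl)
  ultimately show "dual_families I p q" unfolding dual_families_def by blast
qed

text \<open>Off the diagonal, the first adjunction inequality only bounds \<open>bot\<close> from above; the second
  asks that each single \<open>x\<close> contribute at most the identity to the join over \<open>X\<close>. Hence no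
  condition relates two different rows, and a right adjoint can be assembled from
  a dual chosen for each row.\<close>

lemma is_qmap_iff: "is_qmap X Y \<zeta> \<longleftrightarrow> (\<forall>x\<in>X. \<exists>q. dual_families Y (\<zeta> x) q)"
proof
  assume "is_qmap X Y \<zeta>"
  then obtain \<eta> where
    unit: "qrel_le X X qrel_id (qrel_comp Y \<eta> \<zeta>)" and
    counit: "qrel_le Y Y (qrel_comp X \<zeta> \<eta>) qrel_id"
    unfolding is_qmap_def by blast
  have "dual_families Y (\<zeta> x) (\<lambda>y. \<eta> y x)" if x: "x \<in> X" for x
    unfolding dual_families_def
  proof (intro conjI ballI)
    have "qrel_id x x \<le> (SUP i\<in>Y. \<eta> i x * \<zeta> x i)"
      using unit x unfolding qrel_le_def qrel_comp_def by blast
    then show "1 \<le> (SUP i\<in>Y. \<zeta> x i * \<eta> i x)"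
      by (simp add: qrel_id_def mult.commute)
    fix i j assume ij: "i \<in> Y" "j \<in> Y"
    have "\<zeta> x i * \<eta> j x \<le> qrel_comp X \<zeta> \<eta> j i"
      unfolding qrel_comp_def by (rule SUP_upper[OF x])
    also have "\<dots> \<le> qrel_id j i"
      using counit ij unfolding qrel_le_def by blast
    finally show "\<zeta> x i * \<eta> j x \<le> qrel_id i j"
      by (metis qrel_id_def)
  qed
  then show "\<forall>x\<in>X. \<exists>q. dual_families Y (\<zeta> x) q" by blast
next
  assume "\<forall>x\<in>X. \<exists>q. dual_families Y (\<zeta> x) q"
  then obtain q where q: "\<And>x. x \<in> X \<Longrightarrow> dual_families Y (\<zeta> x) (q x)"
    by metis
  let ?\<eta> = "\<lambda>y x. q x y"
  have "qrel_le X X qrel_id (qrel_comp Y ?\<eta> \<zeta>)"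
    using q unfolding qrel_le_def qrel_comp_def qrel_id_def dual_families_def
    by (simp add: mult.commute)
  moreover have "qrel_le Y Y (qrel_comp X \<zeta> ?\<eta>) qrel_id"
    unfolding qrel_le_def qrel_comp_def
  proof (intro ballI SUP_least)
    fix i j x assume "i \<in> Y" "j \<in> Y" "x \<in> X"
    then have "\<zeta> x j * q x i \<le> qrel_id j i"
      using q unfolding dual_families_def by blast
    then show "\<zeta> x j * q x i \<le> qrel_id i j"
      by (metis qrel_id_def)
  qed
  ultimately show "is_qmap X Y \<zeta>" unfolding is_qmap_def by blast
qed

text \<open>This is the uniqueness of right adjoints, for a single row: \<open>\<zeta>\<^sup>*\<close> is the largest family
  whose products with the row lie below the identity, and expanding it along
  the join of the \<open>\<zeta> x z * q z\<close> shows that it does not exceed \<open>q\<close>.\<close>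

lemma qrel_star_eq_dual:
  assumes dual: "dual_families Y (\<zeta> x) q" and y: "y \<in> Y"
  shows "qrel_star Y \<zeta> y x = q y"
proof (rule antisym)
  have "qrel_star Y \<zeta> y x * (\<zeta> x z * q z) \<le> q y" if z: "z \<in> Y" for z
  proof -
    have "qrel_star Y \<zeta> y x * \<zeta> x z \<le> qrel_id y z"
      unfolding qres_adjoint qrel_star_def using z by (rule INF_lower)
    then have "qrel_star Y \<zeta> y x * \<zeta> x z * q z \<le> qrel_id y z * q z"
      by (rule quantale_mult_mono) simp
    also have "\<dots> \<le> q y" by (simp add: qrel_id_def)
    finally show ?thesis by (simp add: mult.assoc)
  qed
  then show "qrel_star Y \<zeta> y x \<le> q y"
    using dual unfolding dual_families_def by (blast intro: le_of_unit_le_SUP)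
next
  show "q y \<le> qrel_star Y \<zeta> y x"
    unfolding qrel_star_def
  proof (rule INF_greatest)
    fix z assume "z \<in> Y"
    then have "\<zeta> x z * q y \<le> qrel_id z y"
      using dual y unfolding dual_families_def by blast
    then show "q y \<le> \<zeta> x z \<rightarrow>\<^sub>Q qrel_id y z"
      unfolding qres_adjoint[symmetric] by (metis mult.commute qrel_id_def)
  qed
qed

text \<open>Given a dual pair \<open>p, q\<close>, the row is realised by a \<open>Q\<close>-map whose domain is one point, for
  which any element of the universe serves.\<close>

lemma all_qmaps_symmetric_iff:
  "(\<forall>(X :: 'u set) (Y :: 'u set) (\<zeta> :: ('u, 'q::comm_unital_quantale) qrel).
      is_qmap X Y \<zeta> \<longrightarrow> symmetric_qmap X Y \<zeta>)
    \<longleftrightarrow> (\<forall>(I :: 'u set) (p :: 'u \<Rightarrow> 'q) q. dual_families I p q \<longrightarrow> (\<forall>i\<in>I. p i = q i))"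
  (is "?symmetric \<longleftrightarrow> ?agree")
proof
  assume ?symmetric
  show ?agree
  proof (intro allI impI ballI)
    fix I and p q :: "'u \<Rightarrow> 'q" and i
    assume dual: "dual_families I p q" and i: "i \<in> I"
    let ?\<zeta> = "\<lambda>(x :: 'u). p" and ?x = "undefined :: 'u"
    have "is_qmap {?x} I ?\<zeta>" using dual unfolding is_qmap_iff by blast
    then have "symmetric_qmap {?x} I ?\<zeta>" using \<open>?symmetric\<close> by blast
    then have "qrel_star I ?\<zeta> i ?x = p i"
      using i unfolding symmetric_qmap_def qrel_eq_def qrel_op_def by blast
    then show "p i = q i" using qrel_star_eq_dual[of I ?\<zeta> ?x q i] dual i by simp
  qed
next
  assume ?agree
  show ?symmetric
  proof (intro allI impI)
    fix X Y :: "'u set" and \<zeta> :: "('u, 'q) qrel"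
    assume qmap: "is_qmap X Y \<zeta>"
    have "qrel_star Y \<zeta> y x = \<zeta> x y" if "y \<in> Y" "x \<in> X" for x y
    proof -
      obtain q where dual: "dual_families Y (\<zeta> x) q"
        using qmap \<open>x \<in> X\<close> unfolding is_qmap_iff by blast
      then have "qrel_star Y \<zeta> y x = q y" using \<open>y \<in> Y\<close> by (rule qrel_star_eq_dual)
      also have "\<dots> = \<zeta> x y" using \<open>?agree\<close> dual \<open>y \<in> Y\<close> by metis
      finally show ?thesis .
    qed
    then show "symmetric_qmap X Y \<zeta>"
      using qmap unfolding symmetric_qmap_def qrel_eq_def qrel_op_def by blast
  qed
qed

text \<open>Expand \<open>p i\<close> along the squares of the meets and bound both factors of each square
  by \<open>q j\<close>. Duality turns \<open>p i * q j\<close> into the identity matrix, so only the diagonal term survives,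
  and the second factor \<open>q i\<close> is what remains of it.\<close>

lemma dual_families_le:
  assumes dual: "dual_families I p q" and i: "i \<in> I"
    and squares: "1 \<le> (SUP j\<in>I. inf (p j) (q j) * inf (p j) (q j))"
  shows "p i \<le> q i"
proof (rule le_of_unit_le_SUP[OF squares])
  fix j assume j: "j \<in> I"
  have "p i * (inf (p j) (q j) * inf (p j) (q j)) \<le> p i * (q j * q j)"
    by (intro quantale_mult_mono) simp_all
  also have "\<dots> = p i * q j * q j" by (simp add: mult.assoc)
  also have "\<dots> \<le> qrel_id i j * q j"
    using dual i j unfolding dual_families_def by (intro quantale_mult_mono) simp_all
  also have "\<dots> \<le> q i" by (simp add: qrel_id_def)
  finally show "p i * (inf (p j) (q j) * inf (p j) (q j)) \<le> q i" .
qed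

lemma dual_families_agree_iff:
  assumes dual: "dual_families I p q"
  shows "(\<forall>i\<in>I. p i = q i) \<longleftrightarrow> 1 \<le> (SUP i\<in>I. inf (p i) (q i) * inf (p i) (q i))"
proof
  assume "\<forall>i\<in>I. p i = q i"
  then have "(SUP i\<in>I. inf (p i) (q i) * inf (p i) (q i)) = (SUP i\<in>I. p i * q i)"
    by (intro SUP_cong) auto
  then show "1 \<le> (SUP i\<in>I. inf (p i) (q i) * inf (p i) (q i))"
    using dual unfolding dual_families_def by simp
next
  assume squares: "1 \<le> (SUP i\<in>I. inf (p i) (q i) * inf (p i) (q i))"
  then have "1 \<le> (SUP i\<in>I. inf (q i) (p i) * inf (q i) (p i))"
    by (simp add: inf.commute)
  with squares show "\<forall>i\<in>I. p i = q i"
    using dual_families_le[OF dual] dual_families_le[OF dual_families_sym[OF dual]]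
    by (blast intro: antisym)
qed

theorem theorem3p13:
  assumes nontrivial: "(bot :: 'q::comm_unital_quantale) < 1"
  shows "(\<forall>(X :: 'u set) (Y :: 'u set) (\<zeta> :: ('u, 'q) qrel). is_qmap X Y \<zeta> \<longrightarrow> symmetric_qmap X Y \<zeta>)
    \<longleftrightarrow> weakly_lean TYPE('u) TYPE('q)"
proof -
  have "weakly_lean TYPE('u) TYPE('q) \<longleftrightarrow>
    (\<forall>(I :: 'u set) (p :: 'u \<Rightarrow> 'q) q. dual_families I p q \<longrightarrow>
      1 \<le> (SUP i\<in>I. inf (p i) (q i) * inf (p i) (q i)))"
    unfolding weakly_lean_def dual_families_iff by (simp only: imp_conjL)
  also have "\<dots> \<longleftrightarrow>
    (\<forall>(I :: 'u set) (p :: 'u \<Rightarrow> 'q) q. dual_families I p q \<longrightarrow> (\<forall>i\<in>I. p i = q i))"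
    by (simp add: dual_families_agree_iff cong: imp_cong)
  finally show ?thesis unfolding all_qmaps_symmetric_iff by (rule sym)
qed

end
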